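(* Let $\mathbf{d}=\mathbf{Z}\mathbf{k}$, $\underline{d}=\min_{n}|d_n|$, and $\mathcal{C}_R=\{\mathbf{v}\in\mathbb{R}^P:\|\mathbf{v}-\mathbf{d}\|_q\le R\}$ for some $R>0$ and $q\ge 1$. Suppose that $$R\le\underline{d},\qquad R(\underline{d}-R)\ge\|\mathbf{Z}\|_q\,\|\mathbf{p}\|_q,\qquad (\underline{d}-R)^2>\|\mathbf{Z}\|_q\,\|\mathbf{p}\|_q .$$ Then there is a unique power flow solution in $\mathcal{C}_R$, and the iterations $$\mathbf{v}^{t+1}=\mathbf{h}(\mathbf{v}^t)=\mathbf{Z}\left[\mathbf{k}-\mathbf{D}(\mathbf{v}^t)\mathbf{p}\right],$$ initialized at any $\mathbf{v}^0\in\mathcal{C}_R$, converge to it.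
   Context: DC network model. A DC power system is a connected undirected graph on the finite bus set $\mathcal{N}^+=\{0,1,\dots,N\}$, which is partitioned into the constant-voltage buses $\mathcal{V}$ (with $0\in\mathcal{V}$) and the remaining buses $\mathcal{P}=\mathcal{N}^+\setminus\mathcal{V}$, with $P=|\mathcal{P}|\ge 1$. Line conductances are $g_{nm}=g_{mn}\ge 0$, with $g_{nm}>0$ iff $n,m$ are joined by a line, and $g_{nn}=0$. Voltages $v_m>0$ are given for $m\in\mathcal{V}$. For each $n\in\mathcal{P}$ the load/generator data are: constant-current component $i_n^o\ge0$, constant-conductance component $g_n^o\ge 0$, and constant-power component $p_n^o\in\mathbb{R}$ (positive for loads, negative for generators). For $n\in\mathcal{P}$ define $$c_n=\sum_{m\in\mathcal{N}^+}g_{nm}+g_n^o,\qquad k_n=\sum_{m\in\mathcal{V}}g_{nm}v_m-i_n^o .$$ Vectors in $\mathbb{R}^P$ are indexed by $\mathcal{P}$; $\mathbf{k}=(k_n)_{n\in\mathcal{P}}$, $\mathbf{p}=(p_n^o)_{n\in\mathcal{P}}$. A power flow (PF) solution is a vector $\mathbf{v}=(v_n)_{n\in\mathcal{P}}$ satisfying $c_nv_n^2=\sum_{m\in\mathcal{P}}g_{nm}v_nv_m+k_nv_n-p_n^o$ for all $n\in\mathcal{P}$; when all $v_n\neq0$ this is equivalent to $\mathbf{v}=\mathbf{h}(\mathbf{v})$. $\mathbf{G}$ is the symmetric $P\times P$ matrix with $G_{nn}=c_n$ and $G_{nm}=-g_{nm}$ for $n\ne m$; it is positive definite, and $\mathbf{Z}=\mathbf{G}^{-1}$.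 $\mathbf{D}(\mathbf{v})$ is the inverse of the diagonal matrix with diagonal entries $v_n$. $\|\cdot\|_q$ is the $\ell_q$ norm for vectors and the induced operator norm for matrices. *)

theory Defs
  imports "HOL-Analysis.Analysis"
begin

text \<open>
  The bus set is the sum type \<open>'v + 'p\<close>: the constant-voltage buses are \<open>Inl m\<close> with \<open>m :: 'v\<close>, the
  remaining buses are \<open>Inr n\<close> with \<open>n :: 'p\<close>.  Both types are finite, and nonempty as all types are;
  this accounts for the reference bus among the constant-voltage buses and for there being at least
  one other bus.  Vectors and matrices over the remaining buses are \<open>real ^ 'p\<close> and \<open>real ^ 'p ^ 'p\<close>.
  Throughout, \<open>g\<close> are the line conductances, \<open>vs\<close> the prescribed voltages, and \<open>io\<close>, \<open>go\<close>, \<open>p\<close>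
  the constant-current, constant-conductance and constant-power components.
\<close>

definition dc_network ::
  "('v::finite + 'p::finite \<Rightarrow> 'v + 'p \<Rightarrow> real) \<Rightarrow> real ^ 'v \<Rightarrow> real ^ 'p \<Rightarrow> real ^ 'p \<Rightarrow> bool"
where
  "dc_network g vs io go \<longleftrightarrow>
     (\<forall>a b. g a b = g b a) \<and> (\<forall>a b. g a b \<ge> 0) \<and> (\<forall>a. g a a = 0) \<and>
     (\<forall>a b. (a, b) \<in> {(a, b). g a b > 0}\<^sup>*) \<and>
     (\<forall>m. vs $ m > 0) \<and> (\<forall>n. io $ n \<ge> 0) \<and> (\<forall>n. go $ n \<ge> 0)"

definition c_coeff ::
  "('v::finite + 'p::finite \<Rightarrow> 'v + 'p \<Rightarrow> real) \<Rightarrow> real ^ 'p \<Rightarrow> real ^ 'p"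
where
  "c_coeff g go = (\<chi> n. (\<Sum>b\<in>UNIV. g (Inr n) b) + go $ n)"

definition k_coeff ::
  "('v::finite + 'p::finite \<Rightarrow> 'v + 'p \<Rightarrow> real) \<Rightarrow> real ^ 'v \<Rightarrow> real ^ 'p \<Rightarrow> real ^ 'p"
where
  "k_coeff g vs io = (\<chi> n. (\<Sum>m\<in>UNIV. g (Inr n) (Inl m) * vs $ m) - io $ n)"

definition pf_solution ::
  "('v::finite + 'p::finite \<Rightarrow> 'v + 'p \<Rightarrow> real) \<Rightarrow> real ^ 'v \<Rightarrow> real ^ 'p \<Rightarrow> real ^ 'p \<Rightarrow> real ^ 'p \<Rightarrow>
    real ^ 'p \<Rightarrow> bool"
where
  "pf_solution g vs io go p v \<longleftrightarrow>
     (\<forall>n. c_coeff g go $ n * (v $ n)\<^sup>2 =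
       (\<Sum>m\<in>UNIV. g (Inr n) (Inr m) * v $ n * v $ m) + k_coeff g vs io $ n * v $ n - p $ n)"

definition G_mat ::
  "('v::finite + 'p::finite \<Rightarrow> 'v + 'p \<Rightarrow> real) \<Rightarrow> real ^ 'p \<Rightarrow> real ^ 'p ^ 'p"
where
  "G_mat g go = (\<chi> n m. if n = m then c_coeff g go $ n else - g (Inr n) (Inr m))"

definition Z_mat ::
  "('v::finite + 'p::finite \<Rightarrow> 'v + 'p \<Rightarrow> real) \<Rightarrow> real ^ 'p \<Rightarrow> real ^ 'p ^ 'p"
where
  "Z_mat g go = matrix_inv (G_mat g go)"

text \<open>As \<open>matrix_inv\<close> is total, \<open>D_mat v\<close> is meaningful only if no entry of \<open>v\<close> vanishes.\<close>

definition D_mat :: "real ^ 'p \<Rightarrow> real ^ 'p ^ 'p" where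
  "D_mat v = matrix_inv (\<chi> n m. if n = m then v $ n else 0)"

definition h_map ::
  "('v::finite + 'p::finite \<Rightarrow> 'v + 'p \<Rightarrow> real) \<Rightarrow> real ^ 'v \<Rightarrow> real ^ 'p \<Rightarrow> real ^ 'p \<Rightarrow> real ^ 'p \<Rightarrow>
    real ^ 'p \<Rightarrow> real ^ 'p"
where
  "h_map g vs io go p v = Z_mat g go *v (k_coeff g vs io - D_mat v *v p)"

text \<open>The exponent is an extended real, so that \<open>q = \<infinity>\<close> gives the maximum norm.\<close>

definition lq_norm :: "ereal \<Rightarrow> real ^ 'p::finite \<Rightarrow> real" where
  "lq_norm q x =
     (if q = \<infinity> then Max (range (\<lambda>n. \<bar>x $ n\<bar>))
      else (\<Sum>n\<in>UNIV. \<bar>x $ n\<bar> powr real_of_ereal q) powr (1 / real_of_ereal q))"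

definition lq_opnorm :: "ereal \<Rightarrow> real ^ 'p ^ 'p::finite \<Rightarrow> real" where
  "lq_opnorm q A = (SUP x\<in>{x. x \<noteq> 0}. lq_norm q (A *v x) / lq_norm q x)"

definition lq_cball :: "ereal \<Rightarrow> real ^ 'p::finite \<Rightarrow> real \<Rightarrow> (real ^ 'p) set" where
  "lq_cball q d R = {v. lq_norm q (v - d) \<le> R}"

end

theory Submission imports Defs begin

text \<open>
  On the ball every \<open>\<bar>v\<^sub>n\<bar>\<close> is at least \<open>\<delta> = dmin - R > 0\<close>, so there the power flow equation says
  \<open>v = h v\<close>, and \<open>h v - d = - Z (p / v)\<close> has \<open>q\<close>-norm at most \<open>\<parallel>Z\<parallel> \<parallel>p\<parallel> / \<delta> \<le> R\<close>.  The entries of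
  \<open>p / v - p / w\<close> are bounded by \<open>\<bar>p\<^sub>n\<bar> \<parallel>v - w\<parallel>\<^sub>\<infinity> / \<delta>\<^sup>2\<close>; hence \<open>h\<close> contracts the maximum norm, which
  the \<open>q\<close>-norm dominates.  Measuring the contraction in the maximum norm avoids Minkowski's
  inequality: only monotonicity of the \<open>q\<close>-norm in the absolute values of the entries is used.
\<close>

section \<open>Fixed points of contractions in the maximum norm\<close>

text \<open>The map \<open>f\<close> need not contract the Euclidean metric of the type, so Banach's
  theorem does not apply directly. By compactness the displacement \<open>infnorm (f x - x)\<close>
  attains its minimum on \<open>S\<close>; one more application of \<open>f\<close> would shrink it
  by the factor \<open>c\<close>, so the minimum is zero.\<close>

lemma infnorm_contraction_fixpoint:
  fixes f :: "'a::euclidean_space \<Rightarrow> 'a"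
  assumes S: "compact S" "S \<noteq> {}" and fS: "\<And>x. x \<in> S \<Longrightarrow> f x \<in> S"
    and c: "0 \<le> c" "c < 1"
    and contr: "\<And>x y. x \<in> S \<Longrightarrow> y \<in> S \<Longrightarrow> infnorm (f x - f y) \<le> c * infnorm (x - y)"
  obtains x where "x \<in> S" "f x = x"
    and "\<And>y. y \<in> S \<Longrightarrow> f y = y \<Longrightarrow> y = x"
    and "\<And>x0. x0 \<in> S \<Longrightarrow> (\<lambda>t. (f ^^ t) x0) \<longlonglongrightarrow> x"
proof -
  \<comment> \<open>Only continuity is wanted here: the constant, which comes from comparing the two
    norms, may exceed 1.\<close>
  have "(sqrt DIM('a) * c)-lipschitz_on S f"
  proof (rule lipschitz_onI)
    fix x y assume xy: "x \<in> S" "y \<in> S"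
    have "dist (f x) (f y) \<le> sqrt DIM('a) * infnorm (f x - f y)"
      unfolding dist_norm by (rule norm_le_infnorm)
    also have "\<dots> \<le> sqrt DIM('a) * (c * norm (x - y))"
      by (intro mult_left_mono order_trans[OF contr[OF xy]] infnorm_le_norm c) auto
    finally show "dist (f x) (f y) \<le> sqrt DIM('a) * c * dist x y"
      by (simp add: dist_norm mult.assoc)
  qed (use c in auto)
  then have "continuous_on S f"
    by (rule lipschitz_on_continuous_on)
  then have "continuous_on S (\<lambda>x. infnorm (f x - x))"
    unfolding continuous_on_def by (auto intro!: tendsto_infnorm tendsto_diff)
  from continuous_attains_inf[OF S this] obtain x where x: "x \<in> S"
    and min: "\<And>y. y \<in> S \<Longrightarrow> infnorm (f x - x) \<le> infnorm (f y - y)" by blast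
  have "infnorm (f x - x) \<le> infnorm (f (f x) - f x)"
    using min fS x by blast
  also have "\<dots> \<le> c * infnorm (f x - x)"
    using contr fS x by blast
  finally have "(1 - c) * infnorm (f x - x) \<le> 0"
    by (simp add: algebra_simps)
  then have fx: "f x = x"
    using c infnorm_pos_lt[of "f x - x"] by (simp add: mult_le_0_iff)
  have lim: "(\<lambda>t. (f ^^ t) x0) \<longlonglongrightarrow> x" if "x0 \<in> S" for x0
  proof -
    have iter: "(f ^^ t) x0 \<in> S \<and> infnorm ((f ^^ t) x0 - x) \<le> c ^ t * infnorm (x0 - x)" for t
    proof (induction t)
      case (Suc t)
      have "infnorm (f ((f ^^ t) x0) - x) \<le> c * infnorm ((f ^^ t) x0 - x)"
        using contr[of "(f ^^ t) x0" x] Suc x fx by simp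
      also have "\<dots> \<le> c * (c ^ t * infnorm (x0 - x))"
        using Suc c by (intro mult_left_mono) auto
      finally show ?case
        using Suc fS by (simp add: mult.assoc)
    qed (use that in auto)
    have "(\<lambda>t. (f ^^ t) x0 - x) \<longlonglongrightarrow> 0"
    proof (rule Lim_null_comparison)
      show "\<forall>\<^sub>F t in sequentially.
          norm ((f ^^ t) x0 - x) \<le> sqrt DIM('a) * (c ^ t * infnorm (x0 - x))"
        by (intro always_eventually allI order_trans[OF norm_le_infnorm] mult_left_mono) (use iter in auto)
      show "(\<lambda>t. sqrt DIM('a) * (c ^ t * infnorm (x0 - x))) \<longlonglongrightarrow> 0"
        using c by (intro tendsto_mult_right_zero tendsto_mult_left_zero LIMSEQ_power_zero) auto
    qed
    then show ?thesis
      by (simp add: LIM_zero_iff)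
  qed
  \<comment> \<open>A fixed point is the limit of its own constant orbit.\<close>
  have "y = x" if y: "y \<in> S" "f y = y" for y
  proof -
    have "(f ^^ t) y = y" for t
      by (induction t) (use y in auto)
    then show ?thesis
      using lim[OF y(1)] by (simp add: LIMSEQ_const_iff)
  qed
  with that x fx lim show thesis by blast
qed

section \<open>The q-norm, its balls and its operator norm\<close>

lemma infnorm_vec_le:
  fixes x :: "real ^ 'n"
  assumes "\<And>n. \<bar>x $ n\<bar> \<le> b"
  shows "infnorm x \<le> b"
  unfolding infnorm_cart using assms by (intro cSup_least) auto

lemma lq_norm_infinity: "lq_norm \<infinity> x = infnorm x"
proof -
  have "range (\<lambda>n. \<bar>x $ n\<bar>) = {\<bar>x $ i\<bar> |i. i \<in> UNIV}"
    by auto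
  then show ?thesis
    unfolding lq_norm_def infnorm_cart
    by (metis (mono_tags) cSup_eq_Max finite finite_imageI image_is_empty UNIV_not_empty)
qed

lemma lq_norm_finite: "q \<noteq> \<infinity> \<Longrightarrow> lq_norm q x =
    (\<Sum>n\<in>UNIV. \<bar>x $ n\<bar> powr real_of_ereal q) powr (1 / real_of_ereal q)"
  by (simp add: lq_norm_def)

lemma real_of_ereal_pos: "0 < q \<Longrightarrow> q \<noteq> \<infinity> \<Longrightarrow> 0 < real_of_ereal q"
  by (cases q) auto

lemma lq_norm_nonneg: "0 \<le> lq_norm q x"
  by (cases "q = \<infinity>") (auto simp: lq_norm_infinity infnorm_pos_le lq_norm_finite)

lemma infnorm_le_lq_norm:
  assumes "0 < q"
  shows "infnorm x \<le> lq_norm q x"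
proof (cases "q = \<infinity>")
  case False
  define r where "r = real_of_ereal q"
  have r: "0 < r"
    using real_of_ereal_pos[OF assms False] by (simp add: r_def)
  show ?thesis
  proof (rule infnorm_vec_le)
    fix n
    have "\<bar>x $ n\<bar> = (\<bar>x $ n\<bar> powr r) powr (1 / r)"
      using r by (simp add: powr_powr)
    also have "\<dots> \<le> (\<Sum>n\<in>UNIV. \<bar>x $ n\<bar> powr r) powr (1 / r)"
      using r by (intro powr_mono2 member_le_sum) auto
    finally show "\<bar>x $ n\<bar> \<le> lq_norm q x"
      using False by (simp add: lq_norm_finite r_def)
  qed
qed (simp add: lq_norm_infinity)

lemma component_le_lq_norm: "0 < q \<Longrightarrow> \<bar>x $ n\<bar> \<le> lq_norm q x"
  using component_le_infnorm_cart infnorm_le_lq_norm by (rule order_trans)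

text \<open>This stands in for the norm axioms: suitable \<open>c\<close> and \<open>y\<close> give
  invariance under a change of sign, the value at 0, and the comparison with \<open>infnorm\<close>,
  where \<open>y\<close> is the all-ones vector.\<close>

lemma lq_norm_le_mult:
  assumes q: "0 < q" and c: "0 \<le> c" and le: "\<And>n. \<bar>x $ n\<bar> \<le> c * \<bar>y $ n\<bar>"
  shows "lq_norm q x \<le> c * lq_norm q y"
proof (cases "q = \<infinity>")
  case True
  have "infnorm x \<le> c * infnorm y"
    by (intro infnorm_vec_le order_trans[OF le] mult_left_mono component_le_infnorm_cart c)
  then show ?thesis
    using True by (simp add: lq_norm_infinity)
next
  case False
  define r where "r = real_of_ereal q"
  have r: "0 < r"
    using real_of_ereal_pos[OF q False] by (simp add: r_def)
  have "(\<Sum>n\<in>UNIV. \<bar>x $ n\<bar> powr r) \<le> (\<Sum>n\<in>UNIV. c powr r * \<bar>y $ n\<bar> powr r)"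
  proof (rule sum_mono)
    fix n
    have "\<bar>x $ n\<bar> powr r \<le> (c * \<bar>y $ n\<bar>) powr r"
      using r le by (intro powr_mono2) auto
    then show "\<bar>x $ n\<bar> powr r \<le> c powr r * \<bar>y $ n\<bar> powr r"
      using c by (simp add: powr_mult)
  qed
  then have "(\<Sum>n\<in>UNIV. \<bar>x $ n\<bar> powr r) powr (1 / r) \<le>
      (c powr r * (\<Sum>n\<in>UNIV. \<bar>y $ n\<bar> powr r)) powr (1 / r)"
    using r by (intro powr_mono2) (auto simp: sum_distrib_left intro!: sum_nonneg)
  also have "\<dots> = c * (\<Sum>n\<in>UNIV. \<bar>y $ n\<bar> powr r) powr (1 / r)"
    using r c by (simp add: powr_mult powr_powr sum_nonneg)
  finally show ?thesis
    using False by (simp add: lq_norm_finite r_def)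
qed

lemma lq_norm_zero: "0 < q \<Longrightarrow> lq_norm q (0 :: real ^ 'n) = 0"
  using lq_norm_le_mult[of q 0 0 "0 :: real ^ 'n"] lq_norm_nonneg[of q "0 :: real ^ 'n"] by simp

lemma lq_norm_pos: "0 < q \<Longrightarrow> x \<noteq> 0 \<Longrightarrow> 0 < lq_norm q x"
  using infnorm_le_lq_norm[of q x] infnorm_pos_lt[of x] by linarith

lemma lq_norm_le_infnorm:
  fixes x :: "real ^ 'n"
  shows "0 < q \<Longrightarrow> lq_norm q x \<le> infnorm x * lq_norm q (1 :: real ^ 'n)"
  by (rule lq_norm_le_mult) (auto simp: infnorm_pos_le component_le_infnorm_cart)

lemma continuous_on_lq_norm:
  assumes "0 < q"
  shows "continuous_on UNIV (lq_norm q :: real ^ 'n \<Rightarrow> real)"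
proof (cases "q = \<infinity>")
  case True
  then show ?thesis
    by (auto simp: lq_norm_infinity continuous_on_def intro!: tendsto_infnorm)
next
  case False
  \<comment> \<open>Both bases may vanish; \<open>powr\<close> is still continuous there because the
    exponents are positive.\<close>
  have "continuous_on UNIV (\<lambda>x :: real ^ 'n.
      (\<Sum>n\<in>UNIV. \<bar>x $ n\<bar> powr real_of_ereal q) powr (1 / real_of_ereal q))"
    using real_of_ereal_pos[OF assms False]
    by (intro continuous_on_powr' continuous_intros) (auto intro!: sum_nonneg)
  then show ?thesis
    using False by (simp add: lq_norm_finite)
qed

text \<open>The ball is a sublevel set of a continuous function, hence closed; it is bounded because
  the q-norm dominates \<open>infnorm\<close>.\<close>

lemma compact_lq_cball:
  assumes "0 < q"
  shows "compact (lq_cball q d R)"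
proof -
  have "continuous_on UNIV (\<lambda>v. lq_norm q (v - d))"
    by (rule continuous_on_compose2[OF continuous_on_lq_norm[OF assms]])
      (auto intro!: continuous_intros)
  then have "closed (lq_cball q d R)"
    unfolding lq_cball_def by (intro closed_Collect_le continuous_intros)
  moreover have "lq_cball q d R \<subseteq> cball d (sqrt DIM(real ^ 'a) * R)"
  proof
    fix v assume "v \<in> lq_cball q d R"
    then have "infnorm (v - d) \<le> R"
      using infnorm_le_lq_norm[OF assms, of "v - d"] by (simp add: lq_cball_def)
    then have "sqrt DIM(real ^ 'a) * infnorm (v - d) \<le> sqrt DIM(real ^ 'a) * R"
      by (intro mult_left_mono) auto
    with norm_le_infnorm have "norm (v - d) \<le> sqrt DIM(real ^ 'a) * R"
      by (rule order_trans)
    then show "v \<in> cball d (sqrt DIM(real ^ 'a) * R)"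
      by (simp only: mem_cball dist_norm norm_minus_commute)
  qed
  ultimately show ?thesis
    using bounded_subset[OF bounded_cball] compact_eq_bounded_closed by blast
qed

text \<open>The point is that the real supremum in \<open>lq_opnorm\<close> is over a set bounded
  above; otherwise it would say nothing about the single quotients.\<close>

lemma lq_norm_mult_le:
  fixes A :: "real ^ 'p ^ 'p"
  assumes q: "0 < q"
  shows "lq_norm q (A *v x) \<le> lq_opnorm q A * lq_norm q x"
proof (cases "x = 0")
  case False
  let ?f = "\<lambda>x. lq_norm q (A *v x) / lq_norm q x"
  \<comment> \<open>The factors of \<open>B\<close> arise from going from the q-norm of
    \<open>A *v y\<close> to \<open>infnorm\<close>, then through the Euclidean operator norm back
    to \<open>infnorm y\<close>.\<close>
  define B where "B = onorm ((*v) A) * sqrt DIM(real ^ 'p) * lq_norm q (1 :: real ^ 'p)"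
  have bound: "?f y \<le> B" if "y \<noteq> 0" for y
  proof -
    have "lq_norm q (A *v y) \<le> infnorm (A *v y) * lq_norm q (1 :: real ^ 'p)"
      by (rule lq_norm_le_infnorm[OF q])
    also have "infnorm (A *v y) \<le> onorm ((*v) A) * (sqrt DIM(real ^ 'p) * infnorm y)"
      by (intro order_trans[OF infnorm_le_norm] order_trans[OF onorm] mult_left_mono
          norm_le_infnorm onorm_pos_le matrix_vector_mul_bounded_linear)
    also have "\<dots> * lq_norm q (1 :: real ^ 'p) = B * infnorm y"
      by (simp add: B_def)
    also have "\<dots> \<le> B * lq_norm q y"
      unfolding B_def
      by (intro mult_left_mono infnorm_le_lq_norm q mult_nonneg_nonneg onorm_pos_le
          matrix_vector_mul_bounded_linear lq_norm_nonneg) auto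
    finally show ?thesis
      using lq_norm_pos[OF q that] by (simp add: divide_le_eq lq_norm_nonneg mult_right_mono)
  qed
  have "?f x \<le> lq_opnorm q A"
    unfolding lq_opnorm_def using False bound by (intro cSUP_upper bdd_aboveI2[where M = B]) auto
  then show ?thesis
    using lq_norm_pos[OF q False] by (simp add: divide_le_eq)
qed (simp add: lq_norm_zero q)

lemma lq_opnorm_nonneg:
  fixes A :: "real ^ 'p ^ 'p"
  assumes "0 < q"
  shows "0 \<le> lq_opnorm q A"
proof -
  have one: "(1 :: real ^ 'p) \<noteq> 0"
    by (simp add: vec_eq_iff)
  have "0 \<le> lq_opnorm q A * lq_norm q (1 :: real ^ 'p)"
    using lq_norm_nonneg lq_norm_mult_le[OF assms] by (rule order_trans)
  then show ?thesis
    using lq_norm_pos[OF assms one] by (simp add: zero_le_mult_iff)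
qed

section \<open>Matrix inverses\<close>

text \<open>Since \<open>matrix_inv\<close> is a choice, a two-sided inverse must be exhibited; for
  square matrices a one-sided one suffices.\<close>

lemma matrix_inv_both:
  fixes A B :: "real ^ 'n ^ 'n"
  assumes "A ** B = mat 1"
  shows "A ** matrix_inv A = mat 1" "matrix_inv A ** A = mat 1"
proof -
  have "B ** A = mat 1"
    using assms by (rule matrix_left_right_inverse[THEN iffD1])
  with assms have "A ** B = mat 1 \<and> B ** A = mat 1" ..
  then have "A ** matrix_inv A = mat 1 \<and> matrix_inv A ** A = mat 1"
    unfolding matrix_inv_def by (rule someI)
  then show "A ** matrix_inv A = mat 1" "matrix_inv A ** A = mat 1" by auto
qed

lemma D_mat_mult:
  fixes v p :: "real ^ 'p"
  assumes "\<And>n. v $ n \<noteq> 0"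
  shows "D_mat v *v p = (\<chi> n. p $ n / v $ n)"
proof -
  let ?V = "\<chi> n m. if n = m then v $ n else 0 :: real ^ 'p ^ 'p"
  let ?W = "\<chi> n m. if n = m then 1 / v $ n else 0 :: real ^ 'p ^ 'p"
  have "(\<Sum>k\<in>UNIV. ?V $ i $ k * ?W $ k $ j) =
      (\<Sum>k\<in>UNIV. if k = i then mat 1 $ i $ j else 0)" for i j
    using assms by (intro sum.cong) (auto simp: mat_def)
  then have "?V ** ?W = mat 1"
    by (simp add: matrix_matrix_mult_def vec_eq_iff)
  then have inv: "D_mat v ** ?V = mat 1"
    unfolding D_mat_def by (rule matrix_inv_both)
  have "(\<Sum>m\<in>UNIV. ?V $ n $ m * (p $ m / v $ m)) = (\<Sum>m\<in>UNIV. if m = n then p $ n else 0)" for n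
    using assms by (intro sum.cong) auto
  \<comment> \<open>Writing \<open>p\<close> as a multiple of \<open>?V\<close> lets
    \<open>D_mat v\<close> cancel without identifying its entries.\<close>
  then have "p = ?V *v (\<chi> n. p $ n / v $ n)"
    by (simp add: matrix_vector_mult_def vec_eq_iff)
  then have "D_mat v *v p = D_mat v *v (?V *v (\<chi> n. p $ n / v $ n))"
    by (rule arg_cong)
  then show ?thesis
    by (simp only: matrix_vector_mul_assoc inv matrix_vector_mul_lid)
qed

section \<open>The network matrix and the power flow equation\<close>

text \<open>The vanishing diagonal of \<open>g\<close> allows the sum to include
  \<open>m = n\<close>.\<close>

lemma G_mat_mult:
  assumes "\<And>a. g a a = 0"
  shows "(G_mat g go *v x) $ n = c_coeff g go $ n * x $ n - (\<Sum>m\<in>UNIV. g (Inr n) (Inr m) * x $ m)"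
proof -
  have "G_mat g go $ n $ m * x $ m =
      (if m = n then c_coeff g go $ n * x $ n else 0) - g (Inr n) (Inr m) * x $ m" for m
    using assms by (auto simp: G_mat_def)
  then show ?thesis
    by (simp add: matrix_vector_mult_def sum_subtractf)
qed

text \<open>
  Maximum principle: a positive maximum of the potential would spread along the lines from a bus
  of variable voltage to the constant-voltage buses, where the potential is extended by \<open>0\<close>.
\<close>

lemma G_mat_kernel_le_0:
  fixes g :: "'v::finite + 'p::finite \<Rightarrow> 'v + 'p \<Rightarrow> real"
  assumes net: "dc_network g vs io go" and ker: "G_mat g go *v x = 0"
  shows "x $ n \<le> 0"
proof (rule ccontr)
  assume pos: "\<not> x $ n \<le> 0"
  define y where "y = (case_sum (\<lambda>_. 0) (\<lambda>n. x $ n) :: 'v + 'p \<Rightarrow> real)"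
  define M where "M = Max (range y)"
  have y_le: "y b \<le> M" for b
    by (simp add: M_def)
  have M_pos: "0 < M"
    using pos y_le[of "Inr n"] by (simp add: y_def)
  have "M \<in> range y"
    unfolding M_def by (rule Max_in) auto
  then obtain a where a: "y a = M"
    by blast
  \<comment> \<open>Row \<open>m\<close> of the kernel equation says that the sum of
    \<open>g b b' * (M - y b')\<close> over all buses is \<open>- (go $ m * M)\<close>, which is at
    most 0. All terms are nonnegative, so each vanishes.\<close>
  have step: "y c = M" if yb: "y b = M" and gbc: "0 < g b c" for b c
  proof -
    obtain m where b: "b = Inr m"
      using yb M_pos by (cases b) (auto simp: y_def)
    have "0 = c_coeff g go $ m * x $ m - (\<Sum>k\<in>UNIV. g (Inr m) (Inr k) * x $ k)"
      using G_mat_mult[of g go x m] net ker by (simp add: dc_network_def)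
    also have "(\<Sum>k\<in>UNIV. g (Inr m) (Inr k) * x $ k) = (\<Sum>b'\<in>UNIV. g b b' * y b')"
      unfolding UNIV_Plus_UNIV[symmetric] by (simp add: sum.Plus b y_def del: UNIV_Plus_UNIV)
    also have "c_coeff g go $ m * x $ m = (\<Sum>b'\<in>UNIV. g b b' * M) + go $ m * M"
      using yb by (simp add: b y_def c_coeff_def distrib_right sum_distrib_right)
    finally have "(\<Sum>b'\<in>UNIV. g b b' * (M - y b')) = - (go $ m * M)"
      by (simp add: right_diff_distrib sum_subtractf)
    also have "\<dots> \<le> 0"
      using net M_pos by (simp add: dc_network_def)
    finally have "(\<Sum>b'\<in>UNIV. g b b' * (M - y b')) = 0"
      using net y_le by (intro antisym sum_nonneg mult_nonneg_nonneg) (auto simp: dc_network_def)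
    then have "g b c * (M - y c) = 0"
      using net y_le by (subst (asm) sum_nonneg_eq_0_iff) (auto simp: dc_network_def)
    with gbc show ?thesis by simp
  qed
  \<comment> \<open>Here \<open>Inl undefined\<close> is just some constant-voltage bus;
    \<open>y\<close> is 0 there, although \<open>M\<close> is positive.\<close>
  have "(a, Inl undefined) \<in> {(a, b). g a b > 0}\<^sup>*"
    using net by (simp add: dc_network_def)
  then have "y (Inl undefined) = M"
    by (induction rule: rtrancl_induct) (use a step in auto)
  with M_pos show False
    by (simp add: y_def)
qed

text \<open>The maximum principle, applied to \<open>x\<close> and to \<open>- x\<close>, shows that
  the kernel is trivial.\<close>

lemma Z_mat_inverse:
  fixes g :: "'v::finite + 'p::finite \<Rightarrow> 'v + 'p \<Rightarrow> real"
  assumes net: "dc_network g vs io go"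
  shows "G_mat g go ** Z_mat g go = mat 1" "Z_mat g go ** G_mat g go = mat 1"
proof -
  have "x = 0" if ker: "G_mat g go *v x = 0" for x
  proof -
    have "G_mat g go *v (- x) = 0"
      using ker by (simp add: vec.neg)
    then have "(- x) $ n \<le> 0" for n
      by (rule G_mat_kernel_le_0[OF net])
    then show ?thesis
      using G_mat_kernel_le_0[OF net ker] by (simp add: vec_eq_iff order_antisym)
  qed
  then obtain B where "B ** G_mat g go = mat 1"
    using matrix_left_invertible_ker by blast
  then have "G_mat g go ** B = mat 1"
    by (rule matrix_left_right_inverse[THEN iffD1])
  then show "G_mat g go ** Z_mat g go = mat 1" "Z_mat g go ** G_mat g go = mat 1"
    unfolding Z_mat_def by (rule matrix_inv_both)+
qed

text \<open>Dividing the equation of bus \<open>n\<close> by \<open>v $ n\<close> gives row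
  \<open>n\<close> of a linear system with matrix \<open>G_mat g go\<close>, which
  \<open>Z_mat g go\<close> then inverts.\<close>

lemma pf_solution_iff_fixpoint:
  assumes net: "dc_network g vs io go" and nz: "\<And>n. v $ n \<noteq> 0"
  shows "pf_solution g vs io go p v \<longleftrightarrow> h_map g vs io go p v = v"
proof -
  let ?u = "k_coeff g vs io - D_mat v *v p"
  have eq: "c * a\<^sup>2 = s * a + k * a - e \<longleftrightarrow> c * a - s = k - e / a" if "a \<noteq> 0" for a c e k s :: real
    using that by (auto simp: field_simps power2_eq_square)
  have "(\<Sum>m\<in>UNIV. g (Inr n) (Inr m) * v $ n * v $ m) =
      (\<Sum>m\<in>UNIV. g (Inr n) (Inr m) * v $ m) * v $ n" for n
    by (simp add: sum_distrib_left mult_ac)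
  then have "pf_solution g vs io go p v \<longleftrightarrow> G_mat g go *v v = ?u"
    using net nz
    by (simp add: pf_solution_def vec_eq_iff G_mat_mult dc_network_def D_mat_mult eq)
  also have "\<dots> \<longleftrightarrow> h_map g vs io go p v = v"
    unfolding h_map_def
    by (metis Z_mat_inverse[OF net] matrix_vector_mul_assoc matrix_vector_mul_lid)
  finally show ?thesis .
qed

section \<open>The iteration map on the ball\<close>

theorem theorem3:
  fixes g :: "'v::finite + 'p::finite \<Rightarrow> 'v + 'p \<Rightarrow> real"
    and vs :: "real ^ 'v" and io go p d :: "real ^ 'p"
    and R dmin :: real and q :: ereal
  assumes "dc_network g vs io go"
    and "d = Z_mat g go *v k_coeff g vs io"
    and "dmin = Min (range (\<lambda>n. \<bar>d $ n\<bar>))"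
    and "R > 0" and "q \<ge> 1"
    and "R \<le> dmin"
    and "R * (dmin - R) \<ge> lq_opnorm q (Z_mat g go) * lq_norm q p"
    and "(dmin - R)\<^sup>2 > lq_opnorm q (Z_mat g go) * lq_norm q p"
  shows "(\<exists>!v. v \<in> lq_cball q d R \<and> pf_solution g vs io go p v) \<and>
    (\<forall>v. v \<in> lq_cball q d R \<and> pf_solution g vs io go p v \<longrightarrow>
      (\<forall>v0 \<in> lq_cball q d R.
        (\<forall>t n. (h_map g vs io go p ^^ t) v0 $ n \<noteq> 0) \<and>
        (\<lambda>t. (h_map g vs io go p ^^ t) v0) \<longlonglongrightarrow> v))"
proof -
  let ?S = "lq_cball q d R" and ?Z = "Z_mat g go" and ?h = "h_map g vs io go p"
  define \<delta> where "\<delta> = dmin - R"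
  define K where "K = lq_opnorm q ?Z * lq_norm q p"
  have q: "0 < q"
    using \<open>1 \<le> q\<close> by (rule less_le_trans[rotated]) simp
  have K: "0 \<le> K" "K \<le> R * \<delta>" "K < \<delta>\<^sup>2"
    using assms(7,8) by (simp_all add: K_def \<delta>_def lq_opnorm_nonneg[OF q] lq_norm_nonneg)
  \<comment> \<open>If \<delta> were 0, then \<open>K < \<delta>\<^sup>2\<close> would contradict
    \<open>0 \<le> K\<close>.\<close>
  have \<delta>: "0 < \<delta>"
    using K(1,3) \<open>R \<le> dmin\<close> by (cases "\<delta> = 0") (auto simp: \<delta>_def)
  have S_ge: "\<delta> \<le> \<bar>v $ n\<bar>" if "v \<in> ?S" for v n
  proof -
    have "\<bar>v $ n - d $ n\<bar> \<le> R"
      using component_le_lq_norm[OF q, of "v - d" n] that by (simp add: lq_cball_def)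
    moreover have "dmin \<le> \<bar>d $ n\<bar>"
      unfolding assms(3) by (rule Min_le) auto
    ultimately show ?thesis
      unfolding \<delta>_def by linarith
  qed
  have S_nz: "v $ n \<noteq> 0" if "v \<in> ?S" for v n
    using S_ge[OF that, of n] \<delta> by auto
  have h_eq: "?h v = d - ?Z *v (\<chi> n. p $ n / v $ n)" if "v \<in> ?S" for v
    using D_mat_mult[OF S_nz[OF that]]
    by (simp add: h_map_def assms(2) matrix_vector_mult_diff_distrib)
  have h_S: "?h v \<in> ?S" if v: "v \<in> ?S" for v
  proof -
    \<comment> \<open>The factor 1 absorbs the minus sign: \<open>?h v - d\<close> is the negative
      of the vector on the right.\<close>
    have "lq_norm q (?h v - d) \<le> 1 * lq_norm q (?Z *v (\<chi> n. p $ n / v $ n))"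
      using q by (rule lq_norm_le_mult) (auto simp: h_eq[OF v])
    also have "\<dots> \<le> lq_opnorm q ?Z * lq_norm q (\<chi> n. p $ n / v $ n)"
      using lq_norm_mult_le[OF q] by simp
    also have "\<dots> \<le> lq_opnorm q ?Z * (1 / \<delta> * lq_norm q p)"
    proof (intro mult_left_mono lq_norm_le_mult q lq_opnorm_nonneg)
      fix n
      show "\<bar>(\<chi> n. p $ n / v $ n) $ n\<bar> \<le> 1 / \<delta> * \<bar>p $ n\<bar>"
        using S_ge[OF v, of n] \<delta> by (auto simp: abs_divide intro!: divide_left_mono mult_pos_pos)
    qed (use \<delta> in auto)
    also have "\<dots> \<le> R"
      using K(2) \<delta> by (simp add: K_def divide_le_eq)
    finally show ?thesis
      by (simp add: lq_cball_def)
  qed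
  have contr: "infnorm (?h v - ?h w) \<le> K / \<delta>\<^sup>2 * infnorm (v - w)"
    if v: "v \<in> ?S" and w: "w \<in> ?S" for v w
  proof -
    define u where "u = (\<chi> n. p $ n / w $ n - p $ n / v $ n)"
    have u_le: "\<bar>u $ n\<bar> \<le> infnorm (v - w) / \<delta>\<^sup>2 * \<bar>p $ n\<bar>" for n
    proof -
      \<comment> \<open>This is the identity 1/w - 1/v = (v - w)/(vw) in each entry; both
        denominators are at least \<delta> in absolute value.\<close>
      have "u $ n = p $ n * (v - w) $ n / (v $ n * w $ n)"
        using S_nz[OF v, of n] S_nz[OF w, of n] by (simp add: u_def field_simps)
      then have "\<bar>u $ n\<bar> = \<bar>p $ n\<bar> * \<bar>(v - w) $ n\<bar> / (\<bar>v $ n\<bar> * \<bar>w $ n\<bar>)"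
        by (simp add: abs_mult abs_divide)
      also have "\<dots> \<le> \<bar>p $ n\<bar> * infnorm (v - w) / \<delta>\<^sup>2"
        unfolding power2_eq_square using \<delta>
        by (intro frac_le mult_mono mult_left_mono component_le_infnorm_cart S_ge v w
            mult_nonneg_nonneg infnorm_pos_le) auto
      finally show ?thesis
        by (simp add: mult.commute)
    qed
    have "?h v - ?h w = ?Z *v ((\<chi> n. p $ n / w $ n) - (\<chi> n. p $ n / v $ n))"
      by (simp add: h_eq v w matrix_vector_mult_diff_distrib)
    also have "(\<chi> n. p $ n / w $ n) - (\<chi> n. p $ n / v $ n) = u"
      by (simp add: u_def vec_eq_iff)
    \<comment> \<open>Passing up to the q-norm makes \<open>lq_opnorm\<close> available;
      \<open>u_le\<close> then brings back the maximum norm of \<open>v - w\<close> as a scalar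
      factor.\<close>
    finally have "infnorm (?h v - ?h w) \<le> lq_norm q (?Z *v u)"
      using infnorm_le_lq_norm[OF q] by simp
    also have "\<dots> \<le> lq_opnorm q ?Z * lq_norm q u"
      by (rule lq_norm_mult_le[OF q])
    also have "\<dots> \<le> lq_opnorm q ?Z * (infnorm (v - w) / \<delta>\<^sup>2 * lq_norm q p)"
      by (intro mult_left_mono lq_norm_le_mult q lq_opnorm_nonneg u_le) (simp add: infnorm_pos_le)
    finally show ?thesis
      by (simp add: K_def mult_ac)
  qed
  have "d \<in> ?S"
    using \<open>R > 0\<close> by (simp add: lq_cball_def lq_norm_zero q)
  then have "?S \<noteq> {}" by blast
  moreover have "0 \<le> K / \<delta>\<^sup>2" "K / \<delta>\<^sup>2 < 1"
    using K \<delta> by auto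
  ultimately obtain v where v: "v \<in> ?S" "?h v = v" "\<And>w. w \<in> ?S \<Longrightarrow> ?h w = w \<Longrightarrow> w = v"
    and lim: "\<And>v0. v0 \<in> ?S \<Longrightarrow> (\<lambda>t. (?h ^^ t) v0) \<longlonglongrightarrow> v"
    using infnorm_contraction_fixpoint[OF compact_lq_cball[OF q] _ h_S _ _ contr] by metis
  have sol: "w \<in> ?S \<and> pf_solution g vs io go p w \<longleftrightarrow> w = v" for w
    using pf_solution_iff_fixpoint[OF assms(1) S_nz] v by metis
  \<comment> \<open>Iterates that stay in the ball have no zero entry, so \<open>D_mat\<close> is a
    genuine inverse at each of them.\<close>
  have "(?h ^^ t) v0 \<in> ?S" if "v0 \<in> ?S" for t v0
    by (induction t) (use that h_S in auto)
  with sol lim S_nz show ?thesis by metis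
qed

end
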